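(* Let $\Lambda_\Phi\subset[0,1]^d$ be a slicing self-affine sponge. If $\Lambda_\Phi$ is non-degenerated and possesses trivial points, then $\Lambda_\Phi$ has a trivial point in $(0,1)^d$.
   Context: Slicing self-affine IFS. Fix $d\ge1$. For each $i\in\{1,\dots,d\}$ let $A_i=\{0,1,\dots,n_i-1\}$ with $n_i\ge 2$ an integer, and let $(\phi_{a,i})_{a\in A_i}$ be contracting similarities of $[0,1]$ into itself such that $[0,1)=\phi_{0,i}[0,1)\cup\cdots\cup\phi_{n_i-1,i}[0,1)$ is a partition of $[0,1)$ into intervals ordered from left to right. For $\mathbf a=(a_1,\dots,a_d)\in A=\prod_{i=1}^d A_i$ put $\phi_{\mathbf a}(x_1,\dots,x_d)=(\phi_{a_1,1}(x_1),\dots,\phi_{a_d,d}(x_d))$. For a nonempty $\mathcal D\subset A$ (the digit set), $\Phi=(\phi_{\mathbf a})_{\mathbf a\in\mathcal D}$ is called a slicing self-affine IFS, and its attractor $\Lambda_\Phi$ (the unique nonempty compact set with $\Lambda_\Phi=\bigcup_{\mathbf a\in\mathcal D}\phi_{\mathbf a}(\Lambda_\Phi)$) is called a slicing self-affine sponge. A connected component of a set is trivial if it is a singleton; a trivial point of a set is a point whose connected component in that set is a singleton. The sponge $\Lambda_\Phi$ is degenerated if it is contained in a $(d-1)$-dimensional face of $[0,1]^d$, i.e. in a set of the form $\{x\in[0,1]^d: x_j=0\}$ or $\{x\in[0,1]^d:x_j=1\}$ for some $1\le j\le d$; otherwise it is non-degenerated. *)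

theory Defs
  imports "HOL-Analysis.Analysis"
begin

definition contracting_similarity_on :: "'a::metric_space set \<Rightarrow> ('a \<Rightarrow> 'a) \<Rightarrow> bool" where
  "contracting_similarity_on S f \<longleftrightarrow>
     f ` S \<subseteq> S \<and>
     (\<exists>r. 0 < r \<and> r < 1 \<and> (\<forall>x\<in>S. \<forall>y\<in>S. dist (f x) (f y) = r * dist x y))"

text \<open>
  One coordinate: \<open>f a\<close> for \<open>a < n\<close> are the maps of that coordinate. Only their
  values on the unit interval are constrained, and only those matter below.
\<close>

definition interval_slicing :: "nat \<Rightarrow> (nat \<Rightarrow> real \<Rightarrow> real) \<Rightarrow> bool" where
  "interval_slicing n f \<longleftrightarrow>
     2 \<le> n \<and>
     (\<forall>a<n. contracting_similarity_on {0..1} (f a)) \<and>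
     (\<Union>a<n. f a ` {0..<1}) = {0..<1} \<and>
     disjoint_family_on (\<lambda>a. f a ` {0..<1}) {..<n} \<and>
     (\<forall>a b. a < b \<and> b < n \<longrightarrow> (\<forall>x\<in>f a ` {0..<1}. \<forall>y\<in>f b ` {0..<1}. x < y))"

text \<open>
  The ambient dimension \<open>d\<close> is \<open>CARD('d)\<close>. A multi-index is a function \<open>'d \<Rightarrow> nat\<close>,
  and \<open>\<phi> i a\<close> is the map with digit \<open>a\<close> in coordinate \<open>i\<close>.
\<close>

definition slice_map :: "('d \<Rightarrow> nat \<Rightarrow> real \<Rightarrow> real) \<Rightarrow> ('d \<Rightarrow> nat) \<Rightarrow> real ^ 'd \<Rightarrow> real ^ 'd"
  where "slice_map \<phi> a x = (\<chi> i. \<phi> i (a i) (x $ i))"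

definition slicing_ifs ::
    "('d::finite \<Rightarrow> nat) \<Rightarrow> ('d \<Rightarrow> nat \<Rightarrow> real \<Rightarrow> real) \<Rightarrow> ('d \<Rightarrow> nat) set \<Rightarrow> bool" where
  "slicing_ifs n \<phi> D \<longleftrightarrow>
     (\<forall>i. interval_slicing (n i) (\<phi> i)) \<and>
     D \<noteq> {} \<and> D \<subseteq> (\<Pi> i\<in>UNIV. {..<n i})"

text \<open>
  The attractor is required to lie in the unit cube because the maps \<open>\<phi> i a\<close>, although
  total functions here, are meaningful on the unit interval only.
\<close>

definition is_attractor ::
    "('d::finite \<Rightarrow> nat \<Rightarrow> real \<Rightarrow> real) \<Rightarrow> ('d \<Rightarrow> nat) set \<Rightarrow> (real ^ 'd) set \<Rightarrow> bool" where
  "is_attractor \<phi> D K \<longleftrightarrow>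
     K \<noteq> {} \<and> compact K \<and> K \<subseteq> cbox 0 1 \<and> K = (\<Union>a\<in>D. slice_map \<phi> a ` K)"

definition trivial_point :: "'a::topological_space set \<Rightarrow> 'a \<Rightarrow> bool" where
  "trivial_point S x \<longleftrightarrow> x \<in> S \<and> connected_component_set S x = {x}"

definition degenerated :: "(real ^ 'd::finite) set \<Rightarrow> bool" where
  "degenerated K \<longleftrightarrow>
     (\<exists>j. K \<subseteq> {x \<in> cbox 0 1. x $ j = 0} \<or> K \<subseteq> {x \<in> cbox 0 1. x $ j = 1})"

end

theory Submission
  imports Defs
begin

text \<open>
  Among the trivial points of the sponge take one, \<open>x\<close>, with as few coordinates in \<open>{0, 1}\<close> as
  possible; it lies in the open cube, because otherwise some image of \<open>x\<close> is a trivial point with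
  fewer such coordinates.

  As \<open>x\<close> is a trivial point of a compact set, it has arbitrarily small neighbourhoods \<open>E\<close> that are
  both open and closed in the sponge, and \<open>E\<close> can be chosen to meet only those faces of the cube
  that contain \<open>x\<close>. A copy of \<open>E\<close> in a cell of some level may be glued to other cells of that level
  along these faces only. If no cell is glued to it, then the copy is again open and closed in the
  sponge and the image of \<open>x\<close> is again a trivial point (\<open>trivial_point_act\<close>). Increasing maps
  of the unit interval into itself send interior coordinates to interior coordinates, so a cell
  that lies off one of the faces through \<open>x\<close> turns a boundary coordinate into an interior one and
  creates none.

  It remains to find an unglued cell off one of the faces through \<open>x\<close> (\<open>exists_isolated_cell\<close>).
  As the sponge is not degenerated, there are cells off each of these faces. If all of them were
  glued, one could walk from any such cell through touching cells towards the faces through \<open>x\<close>,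
  changing only coordinates in which \<open>x\<close> is on the boundary. The end of this walk, rescaled, would
  give for every level a chain of cells joining \<open>x\<close> to an opposite face of the cube, against the
  triviality of \<open>x\<close>.

  Two facts about one coordinate are behind this: the maps are increasing, and two cells of the same
  level meet, if at all, in a left end point of one and a right end point of the other
  (\<open>interval_slicing_increasing\<close>, \<open>interval_slicing_word_meet\<close>).
\<close>

section \<open>One coordinate: interval slicings\<close>

lemma contracting_similarity_on_unit_interval_affine:
  fixes f :: "real \<Rightarrow> real"
  assumes "contracting_similarity_on {0..1} f"
  shows "\<exists>r. 0 < r \<and> r < 1 \<and>
    ((\<forall>x\<in>{0..1}. f x = f 0 + r * x) \<or> (\<forall>x\<in>{0..1}. f x = f 0 - r * x))"
proof -
  obtain r where r: "0 < r" "r < 1"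
    and d: "\<And>x y. x \<in> {0..1} \<Longrightarrow> y \<in> {0..1} \<Longrightarrow> \<bar>f x - f y\<bar> = r * \<bar>x - y\<bar>"
    using assms unfolding contracting_similarity_on_def dist_real_def by blast
  have d0: "\<bar>f x - f 0\<bar> = r * x" if "x \<in> {0..1}" for x
    using d[of x 0] that by simp
  have d1: "\<bar>f 1 - f x\<bar> = r - r * x" if "x \<in> {0..1}" for x
    using d[of 1 x] that by (simp add: algebra_simps)
  have pos: "0 \<le> r * x" "r * x \<le> r" if "x \<in> {0..1}" for x
    using that r by (auto simp: mult_left_le)
  show ?thesis
  proof (cases "f 1 = f 0 + r")
    case True
    have "f x = f 0 + r * x" if "x \<in> {0..1}" for x
      using d0[OF that] d1[OF that] pos[OF that] True r by linarith
    with r show ?thesis by blast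
  next
    case False
    then have e: "f 1 = f 0 - r" using d0[of 1] by (simp add: abs_if split: if_splits)
    have "f x = f 0 - r * x" if "x \<in> {0..1}" for x
      using d0[OF that] d1[OF that] pos[OF that] e r by linarith
    with r show ?thesis by blast
  qed
qed

lemma interval_slicing_same_piece:
  assumes "interval_slicing n f" "a < n" "b < n"
    and "y \<in> {0..<1}" "z \<in> {0..<1}" "f a y = f b z"
  shows "a = b"
proof (rule ccontr)
  assume "a \<noteq> b"
  then have "f a ` {0..<1} \<inter> f b ` {0..<1} = {}"
    using assms(1-3) unfolding interval_slicing_def disjoint_family_on_def by auto
  with assms(4-6) show False by (metis IntI empty_iff imageI)
qed

text \<open>
  A reversed piece is left-open, so its missing left end point lies in another piece. That
  piece has points just to the right of it, hence overlaps the given one, unless it is itself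
  reversed with this point as its right end. The reversed piece furthest to the left therefore
  cannot exist.
\<close>

lemma interval_slicing_increasing:
  assumes S: "interval_slicing n f" and "a < n"
  shows "\<exists>r. 0 < r \<and> r < 1 \<and> (\<forall>x\<in>{0..1}. f a x = f a 0 + r * x)"
proof -
  have sim: "contracting_similarity_on {0..1} (f a)" if "a < n" for a
    using S that unfolding interval_slicing_def by simp
  define R where "R = {a. a < n \<and> (\<exists>r>0. \<forall>x\<in>{0..1}. f a x = f a 0 - r * x)}"
  have "R = {}"
  proof (rule ccontr)
    assume "R \<noteq> {}"
    moreover have "finite R" unfolding R_def by auto
    ultimately obtain a where a: "a \<in> R" and amin: "\<And>b. b \<in> R \<Longrightarrow> f a 0 \<le> f b 0"
      using arg_min_if_finite[of R "\<lambda>a. f a 0"] by (metis not_le)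
    obtain r where r: "r > 0" and fa: "\<And>x. x \<in> {0..1} \<Longrightarrow> f a x = f a 0 - r * x"
      using a unfolding R_def by blast
    have an: "a < n" using a unfolding R_def by blast
    have range: "f a x \<in> {0..1}" if "x \<in> {0..1}" for x
      using sim[OF an] that unfolding contracting_similarity_on_def by blast
    have "f a 1 \<in> {0..<1}"
      using range[of 1] range[of 0] fa[of 1] r by auto
    then obtain b y where b: "b < n" and y: "y \<in> {0..<1}" and e: "f a 1 = f b y"
      using S unfolding interval_slicing_def by blast
    \<comment> \<open>the point \<open>f a (1 - t)\<close> lies \<open>r * t\<close> to the right of the left end point \<open>f a 1\<close>\<close>
    have right: "f a (1 - t) = f b y + r * t" if "0 < t" "t \<le> 1" for t
      using fa[of 1] fa[of "1 - t"] that e by (simp add: algebra_simps)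
    have ab: "a \<noteq> b"
    proof
      assume "a = b"
      then have "r * 1 = r * y" using fa[of 1] fa[of y] y e by simp
      then show False using r y by simp
    qed
    have no: False if "0 < t" "t \<le> 1" "z \<in> {0..<1}" "f b z = f b y + r * t" for t z
      using interval_slicing_same_piece[OF S an b, of "1 - t" z] right[of t] that ab by auto
    obtain q where q: "q > 0" "q < 1" and
      fb: "(\<forall>x\<in>{0..1}. f b x = f b 0 + q * x) \<or> (\<forall>x\<in>{0..1}. f b x = f b 0 - q * x)"
      using contracting_similarity_on_unit_interval_affine[OF sim[OF b]] by blast
    show False
    proof (cases "\<forall>x\<in>{0..1}. f b x = f b 0 + q * x")
      case True
      define s where "s = min (r / q) ((1 - y) / 2)"
      have s: "s \<le> r / q" "s \<le> (1 - y) / 2" unfolding s_def by linarith+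
      have "0 < s" using r q y by (simp add: s_def)
      have "q * s \<le> r" using s(1) q by (simp add: field_simps)
      then have "q * s / r \<le> 1" using r by simp
      moreover have "y + s \<in> {0..<1}" using s \<open>0 < s\<close> y by auto
      moreover have "f b (y + s) = f b y + r * (q * s / r)"
        using bspec[OF True, of y] bspec[OF True, of "y + s"] calculation(2) y r
        by (simp add: algebra_simps)
      ultimately show False using no[of "q * s / r" "y + s"] \<open>0 < s\<close> q r by simp
    next
      case False
      with fb have fb: "\<forall>x\<in>{0..1}. f b x = f b 0 - q * x" by blast
      with q b have bR: "b \<in> R" unfolding R_def by blast
      have "y \<noteq> 0"
      proof
        assume "y = 0"
        then show False using amin[OF bR] e fa[of 1] r by simp
      qed
      define s where "s = min (r / q) y"
      have s: "s \<le> r / q" "s \<le> y" unfolding s_def by linarith+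
      have "0 < s" using r q y \<open>y \<noteq> 0\<close> by (simp add: s_def)
      have "q * s \<le> r" using s(1) q by (simp add: field_simps)
      then have "q * s / r \<le> 1" using r by simp
      moreover have "y - s \<in> {0..<1}" using s \<open>0 < s\<close> y by auto
      moreover have "f b (y - s) = f b y + r * (q * s / r)"
        using bspec[OF fb, of y] bspec[OF fb, of "y - s"] calculation(2) y r
        by (simp add: algebra_simps)
      ultimately show False using no[of "q * s / r" "y - s"] \<open>0 < s\<close> q r by simp
    qed
  qed
  then show ?thesis
    using contracting_similarity_on_unit_interval_affine[OF sim[OF \<open>a < n\<close>]] \<open>a < n\<close>
    unfolding R_def by blast
qed

text \<open>
  Off the end points, coincidences are excluded by disjointness of the pieces. Where two closed
  pieces share a right end point they also overlap just to the left of it.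
\<close>

lemma interval_slicing_meet:
  assumes S: "interval_slicing n f" and ab: "a < n" "b < n"
    and y: "y \<in> {0..1}" and z: "z \<in> {0..1}" and e: "f a y = f b z"
  shows "(a = b \<and> y = z) \<or> (y = 0 \<and> z = 1) \<or> (y = 1 \<and> z = 0)"
proof -
  have right: "a = b" if a: "a < n" and b: "b < n" and y: "y \<in> {0<..1}" and e: "f a y = f b 1"
    for a b y
  proof -
    obtain r where r: "r > 0" and fa: "\<And>x. x \<in> {0..1} \<Longrightarrow> f a x = f a 0 + r * x"
      using interval_slicing_increasing[OF S a] by blast
    obtain q where q: "q > 0" and fb: "\<And>x. x \<in> {0..1} \<Longrightarrow> f b x = f b 0 + q * x"
      using interval_slicing_increasing[OF S b] by blast
    define s where "s = min (r * y) q"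
    have s: "s > 0" "s \<le> r * y" "s \<le> q" using r q y by (auto simp: s_def)
    have 1: "s / r \<le> y" "s / r > 0" "s / q \<le> 1" "s / q > 0"
      using s r q by (auto simp: field_simps)
    have "f a (y - s / r) = f b (1 - s / q)"
      using fa[of y] fa[of "y - s / r"] fb[of 1] fb[of "1 - s / q"] 1 y e r q
      by (simp add: algebra_simps)
    then show "a = b"
      using interval_slicing_same_piece[OF S a b, of "y - s / r" "1 - s / q"] 1 y by auto
  qed
  have inj: "y = z" if "a = b"
  proof -
    obtain r where "r > 0" "\<And>x. x \<in> {0..1} \<Longrightarrow> f a x = f a 0 + r * x"
      using interval_slicing_increasing[OF S ab(1)] by blast
    with e that y z show ?thesis by (metis add_left_cancel mult_left_cancel less_irrefl)
  qed
  consider "y < 1" "z < 1" | "z = 1" "y > 0" | "y = 1" "z > 0" | "z = 1" "y = 0" | "y = 1" "z = 0"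
    using y z by fastforce
  then show ?thesis
  proof cases
    case 1
    then have "a = b" using interval_slicing_same_piece[OF S ab, of y z] y z e by auto
    with inj show ?thesis by simp
  next
    case 2
    then have "a = b" using right[OF ab, of y] y e by auto
    with inj show ?thesis by simp
  next
    case 3
    then have "a = b" using right[OF ab(2,1), of z] z e by auto
    with inj show ?thesis by simp
  qed auto
qed

text \<open>
  A word acts by composing the maps of its letters, the head of the list being applied last;
  words of a fixed length behave like the letters of a finer slicing.
\<close>

lemma interval_slicing_word_unit:
  assumes "interval_slicing n f" "set p \<subseteq> {..<n}" "y \<in> {0..1}"
  shows "foldr f p y \<in> {0..1}"
  using assms(2)
proof (induction p)
  case (Cons a p)
  then have "contracting_similarity_on {0..1} (f a)"
    using assms(1) unfolding interval_slicing_def by auto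
  moreover have "foldr f p y \<in> {0..1}" using Cons by simp
  ultimately show ?case
    unfolding contracting_similarity_on_def by (metis foldr_Cons comp_apply image_subset_iff)
qed (use assms in auto)

lemma interval_slicing_word_less:
  assumes S: "interval_slicing n f" and "set p \<subseteq> {..<n}" "y \<in> {0..1}" "z \<in> {0..1}" "y < z"
  shows "foldr f p y < foldr f p z"
  using assms(2)
proof (induction p)
  case (Cons a p)
  have "a < n" using Cons.prems by simp
  then obtain r where "r > 0" and r: "\<And>x. x \<in> {0..1} \<Longrightarrow> f a x = f a 0 + r * x"
    using interval_slicing_increasing[OF S] by blast
  have u: "foldr f p y \<in> {0..1}" "foldr f p z \<in> {0..1}"
    using interval_slicing_word_unit[OF S] Cons.prems assms by auto
  have "r * foldr f p y < r * foldr f p z" using Cons \<open>r > 0\<close> by simp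
  then show ?case using r[OF u(1)] r[OF u(2)] by simp
qed (use assms in auto)

lemma interval_slicing_word_endpoint:
  assumes S: "interval_slicing n f" and p: "set p \<subseteq> {..<n}" and y: "y \<in> {0..1}"
    and "foldr f p y = e" "e = 0 \<or> e = 1"
  shows "y = e"
proof -
  have "\<not> 0 < y" if "e = 0"
    using interval_slicing_word_less[OF S p, of 0 y] interval_slicing_word_unit[OF S p, of 0]
      y assms(4) that by auto
  moreover have "\<not> y < 1" if "e = 1"
    using interval_slicing_word_less[OF S p, of y 1] interval_slicing_word_unit[OF S p, of 1]
      y assms(4) that by auto
  ultimately show ?thesis using assms(5) y by fastforce
qed

lemma interval_slicing_word_meet:
  assumes S: "interval_slicing n f" and y: "y \<in> {0..1}" and z: "z \<in> {0..1}"
    and "length p = length q" "set p \<subseteq> {..<n}" "set q \<subseteq> {..<n}"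
    and "foldr f p y = foldr f q z"
  shows "(p = q \<and> y = z) \<or> (y = 0 \<and> z = 1) \<or> (y = 1 \<and> z = 0)"
  using assms(4-)
proof (induction p q rule: list_induct2)
  case (Cons a p b q)
  have p: "set p \<subseteq> {..<n}" and q: "set q \<subseteq> {..<n}" and ab: "a < n" "b < n"
    using Cons.prems by auto
  have u: "foldr f p y \<in> {0..1}" "foldr f q z \<in> {0..1}"
    using interval_slicing_word_unit[OF S] p q y z by auto
  have "f a (foldr f p y) = f b (foldr f q z)" using Cons.prems by simp
  from interval_slicing_meet[OF S ab u this]
  consider "a = b" "foldr f p y = foldr f q z" | "foldr f p y = 0" "foldr f q z = 1"
    | "foldr f p y = 1" "foldr f q z = 0" by blast
  then show ?case
  proof cases
    case 1
    with Cons.IH[OF p q] show ?thesis by simp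
  next
    case 2
    then show ?thesis
      using interval_slicing_word_endpoint[OF S p y] interval_slicing_word_endpoint[OF S q z]
      by blast
  next
    case 3
    then show ?thesis
      using interval_slicing_word_endpoint[OF S p y] interval_slicing_word_endpoint[OF S q z]
      by blast
  qed
qed auto

section \<open>The cells of a sponge\<close>

locale slicing_sponge =
  fixes n :: "'d::finite \<Rightarrow> nat"
    and \<phi> :: "'d \<Rightarrow> nat \<Rightarrow> real \<Rightarrow> real"
    and D :: "('d \<Rightarrow> nat) set"
    and \<Lambda> :: "(real ^ 'd) set"
  assumes ifs: "slicing_ifs n \<phi> D"
    and attractor: "is_attractor \<phi> D \<Lambda>"
begin

definition words :: "nat \<Rightarrow> ('d \<Rightarrow> nat) list set" where
  "words k = {u. length u = k \<and> set u \<subseteq> D}"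

abbreviation act :: "('d \<Rightarrow> nat) list \<Rightarrow> real ^ 'd \<Rightarrow> real ^ 'd" where
  "act u \<equiv> foldr (slice_map \<phi>) u"

abbreviation coord_word :: "('d \<Rightarrow> nat) list \<Rightarrow> 'd \<Rightarrow> nat list" where
  "coord_word u i \<equiv> map (\<lambda>a. a i) u"

lemma act_nth: "act u x $ i = foldr (\<phi> i) (coord_word u i) (x $ i)"
  by (induction u) (auto simp: slice_map_def)

lemma coord_word_eqI: "(\<And>i. coord_word u i = coord_word v i) \<Longrightarrow> u = v"
proof (induction u arbitrary: v)
  case (Cons a u)
  then obtain b v' where v: "v = b # v'" by (cases v) auto
  then have "a = b" "\<And>i. coord_word u i = coord_word v' i"
    using Cons.prems by (auto simp: fun_eq_iff)
  with Cons.IH v show ?case by simp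
qed simp

lemma slicing: "interval_slicing (n i) (\<phi> i)"
  using ifs unfolding slicing_ifs_def by blast

lemma digit_less: "a \<in> D \<Longrightarrow> a i < n i"
  using ifs unfolding slicing_ifs_def by auto

lemma finite_digits: "finite D"
proof -
  have "finite (Pi\<^sub>E UNIV (\<lambda>i. {..<n i}))" by (rule finite_PiE) auto
  then show ?thesis using ifs unfolding slicing_ifs_def
    by (auto intro: finite_subset simp: PiE_def)
qed

lemma finite_words: "finite (words k)"
  unfolding words_def using finite_lists_length_eq[OF finite_digits, of k]
  by (simp add: conj_commute)

lemma set_coord_word: "u \<in> words k \<Longrightarrow> set (coord_word u i) \<subseteq> {..<n i}"
  unfolding words_def using digit_less by auto

lemma length_coord_word: "u \<in> words k \<Longrightarrow> length (coord_word u i) = k"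
  unfolding words_def by simp

lemma Cons_in_words_iff: "a # u \<in> words (Suc k) \<longleftrightarrow> a \<in> D \<and> u \<in> words k"
  unfolding words_def by auto

lemma words_SucE:
  assumes "u \<in> words (Suc k)"
  obtains a w where "u = a # w" "a \<in> D" "w \<in> words k"
  using assms Cons_in_words_iff by (cases u) (auto simp: words_def)

lemma attractor_compact: "compact \<Lambda>" and attractor_subset_cube: "\<Lambda> \<subseteq> cbox 0 1"
  and attractor_nonempty: "\<Lambda> \<noteq> {}" and attractor_eq: "\<Lambda> = (\<Union>a\<in>D. slice_map \<phi> a ` \<Lambda>)"
  using attractor unfolding is_attractor_def by blast+

lemma attractor_eq_words: "\<Lambda> = (\<Union>u\<in>words k. act u ` \<Lambda>)"
proof (induction k)
  case 0
  have "words 0 = {[]}" by (auto simp: words_def)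
  then show ?case by simp
next
  case (Suc k)
  have "words (Suc k) = (\<Union>a\<in>D. (#) a ` words k)"
    by (auto simp: Cons_in_words_iff elim!: words_SucE)
  then have "(\<Union>u\<in>words (Suc k). act u ` \<Lambda>) = (\<Union>a\<in>D. slice_map \<phi> a ` (\<Union>u\<in>words k. act u ` \<Lambda>))"
    by (simp add: image_UN image_image) blast
  also have "\<dots> = \<Lambda>" using Suc attractor_eq by simp
  finally show ?case by simp
qed

lemma act_in_attractor: "u \<in> words k \<Longrightarrow> x \<in> \<Lambda> \<Longrightarrow> act u x \<in> \<Lambda>"
  using equalityD2[OF attractor_eq_words[of k]] by blast

lemma in_attractorE:
  assumes "x \<in> \<Lambda>"
  obtains u y where "u \<in> words k" "y \<in> \<Lambda>" "act u y = x"
  using equalityD1[OF attractor_eq_words[of k]] assms by blast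

lemma cube_nth: "x \<in> cbox 0 1 \<Longrightarrow> x $ i \<in> {0..1}" for x :: "real ^ 'd"
  by (simp add: mem_box_cart)

lemma act_nth_unit: "u \<in> words k \<Longrightarrow> x \<in> cbox 0 1 \<Longrightarrow> act u x $ i \<in> {0..1}"
  unfolding act_nth by (rule interval_slicing_word_unit[OF slicing set_coord_word cube_nth])

lemma act_in_cube: "u \<in> words k \<Longrightarrow> x \<in> cbox 0 1 \<Longrightarrow> act u x \<in> cbox 0 1"
  using act_nth_unit by (simp add: mem_box_cart)

text \<open>Increasing maps into the unit interval reach an end point only from the same end point.\<close>

lemma act_boundary:
  assumes "u \<in> words k" "x \<in> cbox 0 1" "act u x $ i = e" "e = 0 \<or> e = 1"
  shows "x $ i = e"
  using interval_slicing_word_endpoint[OF slicing set_coord_word[OF assms(1)] cube_nth[OF assms(2)]]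
    assms(3,4) unfolding act_nth by blast

lemma act_meet:
  assumes "u \<in> words k" "v \<in> words k" "y \<in> cbox 0 1" "z \<in> cbox 0 1" "act u y = act v z"
  shows "(coord_word u i = coord_word v i \<and> y $ i = z $ i) \<or> (y $ i = 0 \<and> z $ i = 1)
    \<or> (y $ i = 1 \<and> z $ i = 0)"
proof (rule interval_slicing_word_meet[OF slicing])
  show "foldr (\<phi> i) (coord_word u i) (y $ i) = foldr (\<phi> i) (coord_word v i) (z $ i)"
    using arg_cong[OF assms(5), of "\<lambda>x. x $ i"] unfolding act_nth .
qed (use assms cube_nth set_coord_word length_coord_word in \<open>auto simp del: set_map\<close>)

lemma inj_on_act:
  assumes "u \<in> words k"
  shows "inj_on (act u) (cbox 0 1)"
proof (rule inj_onI)
  fix y z assume y: "y \<in> cbox 0 1" and z: "z \<in> cbox 0 1" and e: "act u y = act u z"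
  have "y $ i = z $ i" for i
  proof (rule ccontr)
    assume "y $ i \<noteq> z $ i"
    then have "act u y $ i < act u z $ i \<or> act u z $ i < act u y $ i"
      using interval_slicing_word_less[OF slicing set_coord_word[OF assms]] cube_nth[OF y]
        cube_nth[OF z] unfolding act_nth by (meson linorder_neqE)
    with e show False by simp
  qed
  then show "y = z" by (simp add: vec_eq_iff)
qed

text \<open>
  The slope of the map \<open>\<phi> i t\<close> is its increment over the unit interval, and only finitely many
  pairs \<open>(i, t)\<close> matter, so the largest slope is a common contraction ratio.
\<close>

lemma uniform_contraction:
  obtains c where "0 \<le> c" "c < 1" and "\<And>a x y. a \<in> D \<Longrightarrow> x \<in> cbox 0 1 \<Longrightarrow> y \<in> cbox 0 1 \<Longrightarrow>
    dist (slice_map \<phi> a x) (slice_map \<phi> a y) \<le> c * dist x y"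
proof -
  define r where "r i t = \<phi> i t 1 - \<phi> i t 0" for i t
  have slope: "0 < r i t \<and> r i t < 1 \<and> (\<forall>x\<in>{0..1}. \<phi> i t x = \<phi> i t 0 + r i t * x)"
    if t: "t < n i" for i t
  proof -
    obtain q where q: "0 < q" "q < 1" "\<forall>x\<in>{0..1}. \<phi> i t x = \<phi> i t 0 + q * x"
      using interval_slicing_increasing[OF slicing t] by blast
    have eq: "r i t = q" using bspec[OF q(3), of 1] by (simp add: r_def)
    show ?thesis unfolding eq using q by (intro conjI)
  qed
  have r: "0 < r i t \<and> r i t < 1" if "t < n i" for i t
    using slope[OF that] by (elim conjE) (intro conjI)
  have aff: "\<phi> i t x = \<phi> i t 0 + r i t * x" if "t < n i" "x \<in> {0..1}" for i t x
    using slope[OF that(1)] that(2) by (elim conjE) (rule bspec)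
  define R where "R = insert 0 ((\<lambda>(i, t). r i t) ` (SIGMA i:UNIV. {..<n i}))"
  have fin: "finite R" unfolding R_def by auto
  show thesis
  proof (rule that[of "Max R"])
    show "0 \<le> Max R" using fin by (simp add: R_def)
    show "Max R < 1" using fin r by (subst Max_less_iff) (auto simp: R_def)
    fix a and x y :: "real ^ 'd" assume a: "a \<in> D" and x: "x \<in> cbox 0 1" and y: "y \<in> cbox 0 1"
    have "norm ((slice_map \<phi> a x - slice_map \<phi> a y) $ i) \<le> norm ((Max R *\<^sub>R (x - y)) $ i)" for i
    proof -
      have t: "a i < n i" by (rule digit_less[OF a])
      then have m: "r i (a i) \<le> Max R" using fin by (intro Max_ge) (auto simp: R_def)
      have "(slice_map \<phi> a x - slice_map \<phi> a y) $ i = r i (a i) * (x $ i - y $ i)"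
        using aff[OF t cube_nth[OF x]] aff[OF t cube_nth[OF y]]
        by (simp add: slice_map_def algebra_simps)
      moreover have "norm (r i (a i) * (x $ i - y $ i)) \<le> norm (Max R * (x $ i - y $ i))"
        using m r[OF t] by (simp add: abs_mult mult_right_mono)
      ultimately show ?thesis by simp
    qed
    then have "norm (slice_map \<phi> a x - slice_map \<phi> a y) \<le> norm (Max R *\<^sub>R (x - y))"
      by (rule norm_le_componentwise_cart)
    with \<open>0 \<le> Max R\<close> show "dist (slice_map \<phi> a x) (slice_map \<phi> a y) \<le> Max R * dist x y"
      by (simp add: dist_norm)
  qed
qed

lemma act_contraction:
  obtains c where "0 \<le> c" "c < 1" and "\<And>k u x y. u \<in> words k \<Longrightarrow> x \<in> cbox 0 1 \<Longrightarrow>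
    y \<in> cbox 0 1 \<Longrightarrow> dist (act u x) (act u y) \<le> c ^ k * dist x y"
proof -
  obtain c where c: "0 \<le> c" "c < 1" and le: "\<And>a x y. a \<in> D \<Longrightarrow> x \<in> cbox 0 1 \<Longrightarrow>
      y \<in> cbox 0 1 \<Longrightarrow> dist (slice_map \<phi> a x) (slice_map \<phi> a y) \<le> c * dist x y"
    using uniform_contraction by blast
  have "dist (act u x) (act u y) \<le> c ^ k * dist x y"
    if "u \<in> words k" "x \<in> cbox 0 1" "y \<in> cbox 0 1" for k u x y
    using that(1)
  proof (induction k arbitrary: u)
    case (Suc k)
    then obtain a w where u: "u = a # w" "a \<in> D" "w \<in> words k" by (elim words_SucE)
    have "dist (act u x) (act u y) \<le> c * dist (act w x) (act w y)"
      using le[OF u(2) act_in_cube[OF u(3) that(2)] act_in_cube[OF u(3) that(3)]] u(1) by simp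
    also have "\<dots> \<le> c * (c ^ k * dist x y)" by (intro mult_left_mono Suc.IH u c)
    finally show ?case by simp
  qed (simp add: words_def)
  with c show thesis by (rule that)
qed

lemma continuous_on_act:
  assumes "u \<in> words k"
  shows "continuous_on (cbox 0 1) (act u)"
proof -
  obtain c where "0 \<le> c" and "\<And>k u x y. u \<in> words k \<Longrightarrow> x \<in> cbox 0 1 \<Longrightarrow>
      y \<in> cbox 0 1 \<Longrightarrow> dist (act u x) (act u y) \<le> c ^ k * dist x y"
    using act_contraction by metis
  then have "(c ^ k)-lipschitz_on (cbox 0 1) (act u)"
    using assms by (intro lipschitz_onI) auto
  then show ?thesis by (rule lipschitz_on_continuous_on)
qed

lemma small_cells:
  assumes "\<epsilon> > 0"
  obtains k where "\<And>u x y. u \<in> words k \<Longrightarrow> x \<in> cbox 0 1 \<Longrightarrow> y \<in> cbox 0 1 \<Longrightarrow>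
    dist (act u x) (act u y) < \<epsilon>"
proof -
  obtain c where c: "0 \<le> c" "c < 1" and le: "\<And>k u x y. u \<in> words k \<Longrightarrow> x \<in> cbox 0 1 \<Longrightarrow>
      y \<in> cbox 0 1 \<Longrightarrow> dist (act u x) (act u y) \<le> c ^ k * dist x y"
    using act_contraction by metis
  define M where "M = diameter (cbox 0 1 :: (real ^ 'd) set) + 1"
  have M: "dist x y \<le> M" if "x \<in> cbox 0 1" "y \<in> cbox 0 1" for x y :: "real ^ 'd"
    using diameter_bounded_bound[OF bounded_cbox that] by (simp add: M_def)
  have "M > 0" unfolding M_def
    using diameter_ge_0[OF bounded_cbox, of "0 :: real ^ 'd" 1] by linarith
  obtain k where "c ^ k < \<epsilon> / M"
    using real_arch_pow_inv[of "\<epsilon> / M" c] \<open>M > 0\<close> assms c by auto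
  then have k: "c ^ k * M < \<epsilon>" using \<open>M > 0\<close> by (simp add: field_simps)
  show thesis
  proof (rule that)
    fix u and x y :: "real ^ 'd" assume u: "u \<in> words k" and xy: "x \<in> cbox 0 1" "y \<in> cbox 0 1"
    have "c ^ k * dist x y \<le> c ^ k * M" using M[OF xy] c by (intro mult_left_mono) auto
    then show "dist (act u x) (act u y) < \<epsilon>" using le[OF u xy] k by linarith
  qed
qed

section \<open>Trivial points\<close>

lemma trivial_point_clopen_neighbourhood:
  assumes "trivial_point \<Lambda> x" "closed F" "x \<notin> F"
  obtains E where "openin (top_of_set \<Lambda>) E" "compact E" "x \<in> E" "E \<inter> F = {}"
proof -
  have "{x} \<in> components \<Lambda>"
    using assms(1) unfolding trivial_point_def components_def by force
  then show thesis
    using Sura_Bura_clopen_subset[of \<Lambda> "{x}" "- F"] attractor_compact assms that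
    by (metis closed_imp_locally_compact compact_imp_closed compact_sing
        disjoint_eq_subset_Compl empty_subsetI insert_subset open_Compl ComplI)
qed

text \<open>
  If the copy \<open>act u ` E\<close> misses all other cells of its level, it is separated from the rest of the
  sponge by the finitely many compact sets that make up this rest, so the component of \<open>act u x\<close>
  stays inside the copy and is carried back into the component of \<open>x\<close>.
\<close>

lemma trivial_point_act:
  assumes u: "u \<in> words k" and x: "trivial_point \<Lambda> x" "x \<in> E"
    and E: "openin (top_of_set \<Lambda>) E" "compact E"
    and isolated: "\<And>v. v \<in> words k \<Longrightarrow> v \<noteq> u \<Longrightarrow> act u ` E \<inter> act v ` \<Lambda> = {}"
  shows "trivial_point \<Lambda> (act u x)"
proof -
  have sub: "E \<subseteq> \<Lambda>" using openin_imp_subset[OF E(1)] .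
  have cont: "continuous_on S (act v)" if "v \<in> words k" "S \<subseteq> \<Lambda>" for v S
    using continuous_on_act[OF that(1)] that(2) attractor_subset_cube
    by (meson continuous_on_subset order_trans)
  have inj: "inj_on (act u) \<Lambda>"
    using inj_on_act[OF u] attractor_subset_cube by (meson inj_on_subset)
  have rest: "compact (\<Lambda> - E)"
  proof -
    have "closedin (top_of_set \<Lambda>) (\<Lambda> - E)" using E(1) by (simp add: closedin_diff)
    then show ?thesis using attractor_compact closedin_compact by blast
  qed
  define A where "A = act u ` E"
  define B where "B = act u ` (\<Lambda> - E) \<union> (\<Union>v\<in>words k - {u}. act v ` \<Lambda>)"
  have "closed A" unfolding A_def
    using compact_continuous_image[OF cont[OF u sub] E(2)] by (rule compact_imp_closed)
  moreover have "closed B" unfolding B_def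
  proof (intro closed_Un closed_UN ballI)
    show "closed (act u ` (\<Lambda> - E))"
      using compact_continuous_image[OF cont[OF u] rest] by (auto intro: compact_imp_closed)
    show "finite (words k - {u})" using finite_words by simp
    fix v assume "v \<in> words k - {u}"
    then show "closed (act v ` \<Lambda>)"
      using compact_continuous_image[OF cont attractor_compact, of v]
      by (auto intro: compact_imp_closed)
  qed
  moreover have "A \<inter> B = {}"
    unfolding A_def B_def using isolated sub inj_onD[OF inj] by blast
  moreover have "\<Lambda> \<subseteq> A \<union> B"
    unfolding A_def B_def using attractor_eq_words[of k] by blast
  moreover define C where "C = connected_component_set \<Lambda> (act u x)"
  moreover have p: "act u x \<in> \<Lambda>" using act_in_attractor[OF u] x(2) sub by blast
  moreover have "act u x \<in> A" using x(2) by (simp add: A_def)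
  moreover have C: "connected C" "C \<subseteq> \<Lambda>" "act u x \<in> C"
    using p by (auto simp: C_def connected_connected_component connected_component_subset)
  ultimately have CA: "C \<subseteq> A"
    using connected_closedD[OF C(1), of A B] by blast
  obtain g where g: "homeomorphism E A (act u) g"
    using homeomorphism_compact[OF E(2) cont[OF u sub]] inj_on_subset[OF inj sub] A_def by blast
  have gA: "g ` A = E" and gx: "g (act u x) = x" and ag: "\<And>c. c \<in> A \<Longrightarrow> act u (g c) = c"
    using g homeomorphism_image2[OF g] homeomorphism_apply1[OF g x(2)]
      homeomorphism_apply2[OF g] by simp_all
  have "continuous_on C g" using homeomorphism_cont2[OF g] CA by (rule continuous_on_subset)
  then have "connected (g ` C)" using C(1) by (rule connected_continuous_image)
  moreover have "x \<in> g ` C" using C(3) gx by force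
  moreover have "g ` C \<subseteq> \<Lambda>" using image_mono[OF CA, of g] sub unfolding gA by (rule order_trans)
  ultimately have "g ` C \<subseteq> connected_component_set \<Lambda> x"
    by (intro connected_component_maximal)
  then have gC: "g ` C \<subseteq> {x}" using x(1) unfolding trivial_point_def by blast
  have "c = act u x" if "c \<in> C" for c
  proof -
    have "g c = x" using gC that by blast
    moreover have "act u (g c) = c" using ag that CA by blast
    ultimately show ?thesis by simp
  qed
  then have "C \<subseteq> {act u x}" by blast
  then show ?thesis using p C(3) unfolding trivial_point_def C_def by blast
qed

text \<open>
  If every map fixed the coordinate \<open>i\<close> at the face \<open>e\<close>, then each would contract the distance to
  this face; a point of the sponge furthest from the face would then lie on it, and with it the
  whole sponge.
\<close>

lemma digit_moving_face:
  assumes "\<not> degenerated \<Lambda>" "e = 0 \<or> e = 1"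
  obtains a where "a \<in> D" "\<phi> i (a i) e \<noteq> e"
proof (rule ccontr)
  assume "\<not> thesis"
  with that have fixed: "\<And>a. a \<in> D \<Longrightarrow> \<phi> i (a i) e = e" by blast
  have "continuous_on \<Lambda> (\<lambda>y. \<bar>y $ i - e\<bar>)" by (intro continuous_intros)
  then obtain y where y: "y \<in> \<Lambda>" and max: "\<And>z. z \<in> \<Lambda> \<Longrightarrow> \<bar>z $ i - e\<bar> \<le> \<bar>y $ i - e\<bar>"
    using continuous_attains_sup[OF attractor_compact attractor_nonempty] by blast
  obtain a z where a: "a \<in> D" and z: "z \<in> \<Lambda>" and yz: "y = slice_map \<phi> a z"
    using y attractor_eq by blast
  obtain r where r: "0 < r" "r < 1" and aff: "\<And>t. t \<in> {0..1} \<Longrightarrow> \<phi> i (a i) t = \<phi> i (a i) 0 + r * t"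
    using interval_slicing_increasing[OF slicing digit_less[OF a]] by blast
  have "y $ i - e = \<phi> i (a i) (z $ i) - \<phi> i (a i) e"
    using fixed[OF a] by (simp add: yz slice_map_def)
  also have "\<dots> = r * (z $ i - e)"
    using aff[of "z $ i"] aff[of e] cube_nth z attractor_subset_cube assms(2)
    by (auto simp: algebra_simps)
  finally have "\<bar>y $ i - e\<bar> \<le> r * \<bar>y $ i - e\<bar>"
    using max[OF z] r by (simp add: abs_mult)
  then have "(1 - r) * \<bar>y $ i - e\<bar> \<le> 0" by (simp add: algebra_simps)
  then have "\<bar>y $ i - e\<bar> \<le> 0" using r by (simp add: mult_le_0_iff)
  then have "z $ i = e" if "z \<in> \<Lambda>" for z using max[OF that] by simp
  then show False
    using assms attractor_subset_cube unfolding degenerated_def by blast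
qed

section \<open>Moving a trivial point off the boundary\<close>

definition boundary_coords :: "real ^ 'd \<Rightarrow> 'd set" where
  "boundary_coords x = {i. x $ i = 0 \<or> x $ i = 1}"

text \<open>
  This is where the geometry lies. Suppose that every copy \<open>act u ` E\<close> whose corner \<open>act u x\<close> has
  left a boundary face through \<open>x\<close> is touched by another cell of the same level. The points of \<open>E\<close>
  on the boundary of the cube lie only on faces through \<open>x\<close>, so the touching cell \<open>v\<close> sits across a
  face of the cell \<open>u\<close> through \<open>act u x\<close>: it agrees with \<open>u\<close> in the coordinates where \<open>x\<close> is
  interior, and in the others it is either in the same layer or one layer closer to the face
  through \<open>x\<close>. Stepping from cell to cell in this way, starting at \<open>a # b\<close> where \<open>b\<close> codes a cell at
  \<open>x\<close> and \<open>a\<close> leaves a face, one ends in the cell \<open>c # b\<close> whose first letter \<open>c\<close> leaves no face.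
  On the way the walk enters the first-level cell of \<open>c\<close> through a side facing away from \<open>x\<close>. Pulled
  back by \<open>c\<close>, the last part of the walk is a chain of tiny touching cells that leads from a face
  of the cube not containing \<open>x\<close> to the cell of \<open>x\<close>; since the cells are smaller than the gap \<open>\<delta>\<close>
  between \<open>E\<close> and the rest, the sponge within this chain lies in \<open>E\<close>, which keeps a distance \<open>\<delta>\<close>
  from that face.

  The walk is run as a minimality argument. \<open>Q\<close> collects the words which the end of the walk would
  consist of, \<open>R\<close> all other words compatible with \<open>a # b\<close>, and the distance of \<open>act u x\<close> from \<open>x\<close>
  decreases along the walk. A word of \<open>R\<close> minimising it must step into \<open>Q\<close>, which is then refuted.
\<close>

lemma exists_isolated_cell:
  assumes nondeg: "\<not> degenerated \<Lambda>" and E: "E \<subseteq> \<Lambda>" "x \<in> E" and "\<delta> > 0"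
    and gap: "\<And>y z. y \<in> E \<Longrightarrow> z \<in> \<Lambda> - E \<Longrightarrow> \<delta> \<le> dist y z"
    and far: "\<And>y z i. y \<in> E \<Longrightarrow> z $ i = 0 \<or> z $ i = 1 \<Longrightarrow> z $ i \<noteq> x $ i \<Longrightarrow> \<delta> \<le> dist y z"
    and "boundary_coords x \<noteq> {}"
  obtains (isolated) k u i where "u \<in> words k" "i \<in> boundary_coords x" "act u x $ i \<noteq> x $ i"
    and "\<And>v. v \<in> words k \<Longrightarrow> v \<noteq> u \<Longrightarrow> act u ` E \<inter> act v ` \<Lambda> = {}"
proof (rule ccontr)
  assume no: "\<not> thesis"
  have touched: "\<exists>v\<in>words k. v \<noteq> u \<and> act u ` E \<inter> act v ` \<Lambda> \<noteq> {}"
    if "u \<in> words k" "i \<in> boundary_coords x" "act u x $ i \<noteq> x $ i" for k u i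
  proof (rule ccontr)
    assume "\<not> ?thesis"
    then have "act u ` E \<inter> act v ` \<Lambda> = {}" if "v \<in> words k" "v \<noteq> u" for v
      using that by blast
    from no isolated[OF that this] show False by (rule notE)
  qed
  have cube: "y \<in> cbox 0 1" if "y \<in> \<Lambda>" for y using that attractor_subset_cube by blast
  have x: "x \<in> \<Lambda>" "x \<in> cbox 0 1" using E cube by auto
  have near: "z \<in> E" if "y \<in> E" "z \<in> \<Lambda>" "dist y z < \<delta>" for y z
    using gap[OF that(1), of z] that by fastforce
  \<comment> \<open>\<open>E\<close> meets no boundary face other than those through \<open>x\<close>\<close>
  have face: "y $ i = x $ i" if "y \<in> E" "y $ i = 0 \<or> y $ i = 1" for y i
    using far[OF that(1) that(2)] \<open>\<delta> > 0\<close> by fastforce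
  obtain k where small: "\<And>u x y. u \<in> words k \<Longrightarrow> x \<in> cbox 0 1 \<Longrightarrow> y \<in> cbox 0 1 \<Longrightarrow>
      dist (act u x) (act u y) < \<delta>"
    using small_cells[OF \<open>\<delta> > 0\<close>] by blast
  obtain b x0 where b: "b \<in> words k" and x0: "x0 \<in> \<Lambda>" "act b x0 = x"
    using in_attractorE[OF x(1)] .
  have bE: "act b x \<in> E"
    using near[OF E(2) act_in_attractor[OF b x(1)]] small[OF b cube[OF x0(1)] x(2)] x0(2) by simp
  have b_fix: "act b x $ i = x $ i" if "i \<in> boundary_coords x" for i
  proof -
    have "x0 $ i = x $ i"
      using act_boundary[OF b cube[OF x0(1)], of i "x $ i"] x0(2) that
      unfolding boundary_coords_def by simp
    then have "act b x $ i = act b x0 $ i" by (simp add: act_nth)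
    with x0(2) show ?thesis by simp
  qed
  obtain i0 where i0: "i0 \<in> boundary_coords x" using assms(7) by blast
  then obtain a where a: "a \<in> D" and a_move: "\<phi> i0 (a i0) (x $ i0) \<noteq> x $ i0"
    using digit_moving_face[OF nondeg] unfolding boundary_coords_def by blast
  have ab: "a # b \<in> words (Suc k)" using a b by (simp add: Cons_in_words_iff)
  define Q where "Q = {c # w |c w. c \<in> D \<and> w \<in> words k \<and> act w x \<in> E \<and>
    (\<forall>i\<in>boundary_coords x. \<phi> i (c i) (x $ i) = x $ i)}"
  define R where "R = {u \<in> words (Suc k).
    \<forall>j. j \<notin> boundary_coords x \<longrightarrow> coord_word u j = coord_word (a # b) j} - Q"
  define M where "M = (\<lambda>u. \<Sum>i\<in>UNIV. \<bar>act u x $ i - x $ i\<bar>)"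
  have "a # b \<in> R"
    using ab a_move i0 by (auto simp: R_def Q_def)
  moreover have "finite R" unfolding R_def using finite_words by simp
  ultimately obtain u where u: "u \<in> R" and min: "\<And>v. v \<in> R \<Longrightarrow> M u \<le> M v"
    using arg_min_if_finite[of R M] by (metis empty_iff not_le)
  have uw: "u \<in> words (Suc k)" and uQ: "u \<notin> Q"
    and uJ: "\<And>j. j \<notin> boundary_coords x \<Longrightarrow> coord_word u j = coord_word (a # b) j"
    using u by (auto simp: R_def)
  obtain a' w' where u_eq: "u = a' # w'" and a': "a' \<in> D" and w': "w' \<in> words k"
    using uw by (elim words_SucE)
  have "\<exists>i\<in>boundary_coords x. act u x $ i \<noteq> x $ i"
  proof (rule ccontr)
    \<comment> \<open>otherwise \<open>w'\<close> sends \<open>x\<close> to the same point of \<open>E\<close> as \<open>b\<close>, and \<open>u\<close> is an end of the walk\<close>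
    assume "\<not> ?thesis"
    then have fixed: "\<phi> i (a' i) (act w' x $ i) = x $ i" if "i \<in> boundary_coords x" for i
      using that by (simp add: u_eq slice_map_def)
    have "[a'] \<in> words 1" using a' by (simp add: words_def)
    then have w_fix: "act w' x $ i = x $ i" if "i \<in> boundary_coords x" for i
      using act_boundary[OF _ act_in_cube[OF w' x(2)], of "[a']" 1 i "x $ i"] fixed[OF that] that
      unfolding boundary_coords_def by (simp add: slice_map_def)
    have "act w' x $ i = act b x $ i" for i
    proof (cases "i \<in> boundary_coords x")
      case True
      then show ?thesis using w_fix b_fix by simp
    next
      case False
      then have "coord_word w' i = coord_word b i" using uJ[OF False] u_eq by simp
      then show ?thesis by (simp add: act_nth)
    qed
    then have "act w' x = act b x" by (simp add: vec_eq_iff)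
    then have "u \<in> Q" using a' w' bE fixed w_fix by (auto simp: Q_def u_eq)
    with uQ show False by simp
  qed
  then obtain v y z where v: "v \<in> words (Suc k)" "v \<noteq> u" and y: "y \<in> E" and z: "z \<in> \<Lambda>"
    and meet: "act u y = act v z"
    using touched[OF uw] by blast
  have yc: "y \<in> cbox 0 1" and zc: "z \<in> cbox 0 1" using y z E(1) cube by auto
  have alt: "coord_word u i = coord_word v i \<or>
      i \<in> boundary_coords x \<and> y $ i = x $ i \<and> z $ i = 1 - x $ i" for i
    using act_meet[OF uw v(1) yc zc meet, of i] face[OF y, of i]
    unfolding boundary_coords_def by auto
  \<comment> \<open>where the words differ, \<open>v\<close> lies on the side of \<open>u\<close> facing the boundary value \<open>x $ i\<close>\<close>
  have "M v < M u"
  proof -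
    have le: "\<bar>act v x $ i - x $ i\<bar> < \<bar>act u x $ i - x $ i\<bar>"
      if "coord_word u i \<noteq> coord_word v i" for i
    proof -
      from alt[of i] that have i: "i \<in> boundary_coords x" "y $ i = x $ i" "z $ i = 1 - x $ i"
        by blast+
      have "act u x $ i = act v z $ i" using arg_cong[OF meet, of "\<lambda>p. p $ i"] i(2)
        by (simp add: act_nth)
      moreover have "act v x $ i \<in> {0..1}" "act v z $ i \<in> {0..1}"
        using act_nth_unit[OF v(1)] x(2) zc by blast+
      moreover have "act v x $ i < act v z $ i" if "x $ i = 0"
        using interval_slicing_word_less[OF slicing set_coord_word[OF v(1)], of 0 1 i] that i(3)
        unfolding act_nth by simp
      moreover have "act v z $ i < act v x $ i" if "x $ i = 1"
        using interval_slicing_word_less[OF slicing set_coord_word[OF v(1)], of 0 1 i] that i(3)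
        unfolding act_nth by simp
      ultimately show ?thesis using i(1) unfolding boundary_coords_def by auto
    qed
    have same: "\<bar>act v x $ i - x $ i\<bar> = \<bar>act u x $ i - x $ i\<bar>"
      if "coord_word u i = coord_word v i" for i
      using that by (simp add: act_nth)
    obtain i where i: "coord_word u i \<noteq> coord_word v i"
      using v(2) coord_word_eqI by metis
    show ?thesis unfolding M_def
    proof (intro sum_strict_mono_ex1 ballI)
      fix j
      show "\<bar>act v x $ j - x $ j\<bar> \<le> \<bar>act u x $ j - x $ j\<bar>"
        by (cases "coord_word u j = coord_word v j") (use le same in \<open>auto intro: less_imp_le\<close>)
    qed (use le i in auto)
  qed
  moreover have "coord_word v j = coord_word (a # b) j" if "j \<notin> boundary_coords x" for j
    using alt[of j] uJ[OF that] that by auto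
  ultimately have "v \<in> Q" using min[of v] v(1) by (force simp: R_def)
  then obtain c w where v_eq: "v = c # w" and c: "c \<in> D" and w: "w \<in> words k"
    and wE: "act w x \<in> E" and c_fix: "\<And>i. i \<in> boundary_coords x \<Longrightarrow> \<phi> i (c i) (x $ i) = x $ i"
    by (auto simp: Q_def)
  have wz: "act w z \<in> E"
    using near[OF wE act_in_attractor[OF w z] small[OF w x(2) zc]] .
  \<comment> \<open>a step between different first-level cells would put \<open>act w z\<close>, a point of \<open>E\<close>, on the
    boundary of the cube, hence on a face through \<open>x\<close>; as \<open>c\<close> maps this face into itself, the cell
    of \<open>a'\<close> would have to lie outside the cube\<close>
  have "a' = c"
  proof (rule ccontr)
    assume "a' \<noteq> c"
    then obtain i where i: "a' i \<noteq> c i" by blast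
    have w'y: "act w' y $ i \<in> {0..1}" and wz1: "act w z $ i \<in> {0..1}"
      using act_nth_unit[OF w' yc] act_nth_unit[OF w zc] by blast+
    have e: "\<phi> i (a' i) (act w' y $ i) = \<phi> i (c i) (act w z $ i)"
      using arg_cong[OF meet, of "\<lambda>p. p $ i"] by (simp add: u_eq v_eq slice_map_def)
    from interval_slicing_meet[OF slicing digit_less[OF a'] digit_less[OF c] w'y wz1 e] i
    have *: "act w' y $ i = 1 - act w z $ i" "act w z $ i = 0 \<or> act w z $ i = 1" by auto
    then have wzx: "act w z $ i = x $ i" using face[OF wz] by blast
    then have "i \<in> boundary_coords x" using *(2) by (simp add: boundary_coords_def)
    then have "\<phi> i (a' i) (1 - x $ i) = x $ i" using e * wzx c_fix by simp
    then have "1 - x $ i = x $ i"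
      using interval_slicing_word_endpoint[OF slicing, of "[a' i]" i "1 - x $ i" "x $ i"]
        digit_less[OF a'] *(2) wzx cube_nth[OF x(2), of i] by auto
    then show False using *(2) wzx by simp
  qed
  have "act w' y = act w z"
  proof -
    have "slice_map \<phi> a' (act w' y) = slice_map \<phi> a' (act w z)"
      using meet by (simp add: u_eq v_eq \<open>a' = c\<close>)
    moreover have "[a'] \<in> words 1" using a' by (simp add: words_def)
    ultimately show ?thesis
      using inj_onD[OF inj_on_act[of "[a']" 1]] act_in_cube[OF w' yc] act_in_cube[OF w zc] by simp
  qed
  then have "act w' x \<in> E"
    using near[OF wz act_in_attractor[OF w' x(1)]] small[OF w' yc x(2)] by simp
  then have "u \<in> Q" using a' w' c_fix \<open>a' = c\<close> by (auto simp: Q_def u_eq)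
  with uQ show False by simp
qed

text \<open>
  Any boundary coordinate of \<open>act u x\<close> is one of \<open>x\<close>, with the same value; hence the coordinate that
  the isolated cell moves is lost.
\<close>

lemma trivial_point_fewer_boundary_coords:
  assumes "\<not> degenerated \<Lambda>" "trivial_point \<Lambda> x" "boundary_coords x \<noteq> {}"
  obtains x' where "trivial_point \<Lambda> x'" "boundary_coords x' \<subset> boundary_coords x"
proof -
  have x: "x \<in> cbox 0 1"
    using assms(2) attractor_subset_cube unfolding trivial_point_def by blast
  \<comment> \<open>the hyperplanes spanned by the faces of the cube that do not contain \<open>x\<close>\<close>
  define F where "F = (\<Union>i. \<Union>e\<in>{0, 1} - {x $ i}. {z. z $ i = e})"
  have F: "closed F" unfolding F_def
    by (intro closed_UN ballI closed_Collect_eq continuous_intros) auto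
  have "x \<notin> F" by (auto simp: F_def)
  with assms(2) F obtain E where E: "openin (top_of_set \<Lambda>) E" "compact E" "x \<in> E" "E \<inter> F = {}"
    by (rule trivial_point_clopen_neighbourhood)
  have sub: "E \<subseteq> \<Lambda>" using openin_imp_subset[OF E(1)] .
  have "closedin (top_of_set \<Lambda>) (\<Lambda> - E)" using E(1) by (simp add: closedin_diff)
  then have "closed (\<Lambda> - E)"
    using attractor_compact closedin_closed_trans compact_imp_closed by blast
  with F E(2,4) obtain \<delta> where \<delta>: "\<delta> > 0" and sep: "\<And>y z. y \<in> E \<Longrightarrow> z \<in> (\<Lambda> - E) \<union> F \<Longrightarrow> \<delta> \<le> dist y z"
    using separate_compact_closed[of E "(\<Lambda> - E) \<union> F"] by (metis Diff_disjoint Int_Un_distrib Un_empty closed_Un)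
  obtain k u i where u: "u \<in> words k" and i: "i \<in> boundary_coords x" "act u x $ i \<noteq> x $ i"
    and isolated: "\<And>v. v \<in> words k \<Longrightarrow> v \<noteq> u \<Longrightarrow> act u ` E \<inter> act v ` \<Lambda> = {}"
  proof (rule exists_isolated_cell[OF assms(1) sub E(3) \<delta> _ _ assms(3)])
    show "\<delta> \<le> dist y z" if "y \<in> E" "z \<in> \<Lambda> - E" for y z using sep that by blast
    show "\<delta> \<le> dist y z" if "y \<in> E" "z $ i = 0 \<or> z $ i = 1" "z $ i \<noteq> x $ i" for y z i
      using sep[OF that(1), of z] that by (auto simp: F_def)
  qed blast
  have keep: "act u x $ j = x $ j" if "j \<in> boundary_coords (act u x)" for j
    using act_boundary[OF u x, of j "act u x $ j"] that unfolding boundary_coords_def by auto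
  have "boundary_coords (act u x) \<subset> boundary_coords x"
  proof
    show "boundary_coords (act u x) \<subseteq> boundary_coords x"
      using keep unfolding boundary_coords_def by fastforce
    show "boundary_coords (act u x) \<noteq> boundary_coords x" using keep i by blast
  qed
  with trivial_point_act[OF u assms(2) E(3,1,2) isolated] that show thesis by blast
qed

end

theorem theorem1p2:
  fixes n :: "'d::finite \<Rightarrow> nat"
    and \<phi> :: "'d \<Rightarrow> nat \<Rightarrow> real \<Rightarrow> real"
    and D :: "('d \<Rightarrow> nat) set"
    and \<Lambda> :: "(real ^ 'd) set"
  assumes "slicing_ifs n \<phi> D"
    and "is_attractor \<phi> D \<Lambda>"
    and "\<not> degenerated \<Lambda>"
    and "\<exists>x. trivial_point \<Lambda> x"
  shows "\<exists>x. trivial_point \<Lambda> x \<and> x \<in> box 0 1"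
proof -
  interpret slicing_sponge n \<phi> D \<Lambda> using assms(1,2) by unfold_locales
  obtain x where x: "trivial_point \<Lambda> x"
    and min: "\<And>x'. trivial_point \<Lambda> x' \<Longrightarrow> card (boundary_coords x) \<le> card (boundary_coords x')"
    using ex_has_least_nat[of "trivial_point \<Lambda>" _ "\<lambda>x. card (boundary_coords x)"] assms(4) by blast
  have "boundary_coords x = {}"
  proof (rule ccontr)
    assume "boundary_coords x \<noteq> {}"
    then obtain x' where "trivial_point \<Lambda> x'" "boundary_coords x' \<subset> boundary_coords x"
      using trivial_point_fewer_boundary_coords[OF assms(3) x] by blast
    with min show False by (meson finite not_le psubset_card_mono)
  qed
  then have "x $ i \<noteq> 0 \<and> x $ i \<noteq> 1" for i unfolding boundary_coords_def by blast
  moreover have "x \<in> cbox 0 1"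
    using x attractor_subset_cube unfolding trivial_point_def by blast
  ultimately have "x \<in> box 0 1" by (auto simp: mem_box_cart less_le)
  with x show ?thesis by blast
qed

end
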